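(* Let $m\ge 3$ be an odd integer and let $n\ge 6$ be an even integer. (1) If $n\equiv 2\pmod 4$, then the number of Klein bottle nonequivalent $C_4$-face-magic Klein bottle labelings of $\mathcal{K}_{m,n}$ is at least $(6\cdot 2^m)(m-1)!$. (2) If $n\equiv 0\pmod 4$, then the number of Klein bottle nonequivalent $C_4$-face-magic Klein bottle labelings of $\mathcal{K}_{m,n}$ is at least $(5\cdot 2^m)(m-1)!$.
   Context: For integers $m,n\ge 2$, the $m\times n$ Klein bottle grid graph $\mathcal{K}_{m,n}$ has vertex set $\{(i,j):1\le i\le m,\ 1\le j\le n\}$ and edges $(i,j)(i,j+1)$ for $1\le j\le n-1$; $(i,n)(i,1)$; $(i,j)(i+1,j)$ for $1\le i\le m-1$; and $(m,j)(1,n+1-j)$ for $1\le j\le n$. Its $4$-cycle faces in the natural Klein bottle embedding are, with column indices modulo $n$, $\{(i,j),(i,j+1),(i+1,j),(i+1,j+1)\}$ for $1\le i\le m-1$, $1\le j\le n$, and $\{(m,j),(m,j+1),(1,n+1-j),(1,n-j)\}$ for $1\le j\le n$. A $C_4$-face-magic Klein bottle labeling is a bijection $X=\{x_{i,j}\}$ from the vertices to $\{1,\dots,mn\}$ such that all these $4$-cycle face sums are equal. For $n$ even, define $U(i,j)=(i+1,j)$ for $1\le i\le m-1$, $U(m,j)=(1,n+1-j)$; $H(i,j)=(i,j+n/2)$ (column index modulo $n$); $F(i,j)=(i,n+1-j)$; let $KBLS(m,n)=\langle U,H,F\rangle$ (the graph automorphisms induced by homeomorphisms of the Klein bottle preserving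 the embedded graph). For $A\in KBLS(m,n)$ let $A(X)=\{x_{A(i,j)}\}$. Two labelings $X,X'$ are Klein bottle equivalent if $X'=A(X)$ for some $A\in KBLS(m,n)$; "number of nonequivalent labelings" means the number of equivalence classes. *)

theory Defs
  imports "HOL-Algebra.Bij" "HOL-Algebra.Generated_Groups"
begin

definition kb_verts :: "nat \<Rightarrow> nat \<Rightarrow> (nat \<times> nat) set" where
  "kb_verts m n = {1..m} \<times> {1..n}"

text \<open>The representative of \<open>j\<close> modulo \<open>n\<close> in \<open>{1..n}\<close>; adding \<open>n\<close> before
  subtracting \<open>1\<close> sends \<open>j = 0\<close> to \<open>n\<close> despite truncated subtraction.\<close>

definition kb_col :: "nat \<Rightarrow> nat \<Rightarrow> nat" where
  "kb_col n j = (j + n - 1) mod n + 1"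

definition kb_edges :: "nat \<Rightarrow> nat \<Rightarrow> (nat \<times> nat) set set" where
  "kb_edges m n =
     {{(i, j), (i, j + 1)} | i j. i \<in> {1..m} \<and> j \<in> {1..n - 1}} \<union>
     {{(i, n), (i, 1)} | i. i \<in> {1..m}} \<union>
     {{(i, j), (i + 1, j)} | i j. i \<in> {1..m - 1} \<and> j \<in> {1..n}} \<union>
     {{(m, j), (1, n + 1 - j)} | j. j \<in> {1..n}}"

definition kb_faces :: "nat \<Rightarrow> nat \<Rightarrow> (nat \<times> nat) set set" where
  "kb_faces m n =
     {{(i, j), (i, kb_col n (j + 1)), (i + 1, j), (i + 1, kb_col n (j + 1))}
        | i j. i \<in> {1..m - 1} \<and> j \<in> {1..n}} \<union>
     {{(m, j), (m, kb_col n (j + 1)), (1, n + 1 - j), (1, kb_col n (n - j))}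
        | j. j \<in> {1..n}}"

text \<open>Labelings are extensional functions on the vertex set, so that distinct functions are
  distinct labelings.\<close>

definition kb_labelings :: "nat \<Rightarrow> nat \<Rightarrow> (nat \<times> nat \<Rightarrow> nat) set" where
  "kb_labelings m n =
     {X \<in> extensional (kb_verts m n).
        bij_betw X (kb_verts m n) {1..m * n} \<and>
        (\<exists>S. \<forall>f \<in> kb_faces m n. (\<Sum>v\<in>f. X v) = S)}"

definition kb_U :: "nat \<Rightarrow> nat \<Rightarrow> nat \<times> nat \<Rightarrow> nat \<times> nat" where
  "kb_U m n = (\<lambda>(i, j)\<in>kb_verts m n. if i < m then (i + 1, j) else (1, n + 1 - j))"

definition kb_H :: "nat \<Rightarrow> nat \<Rightarrow> nat \<times> nat \<Rightarrow> nat \<times> nat" where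
  "kb_H m n = (\<lambda>(i, j)\<in>kb_verts m n. (i, kb_col n (j + n div 2)))"

definition kb_F :: "nat \<Rightarrow> nat \<Rightarrow> nat \<times> nat \<Rightarrow> nat \<times> nat" where
  "kb_F m n = (\<lambda>(i, j)\<in>kb_verts m n. (i, n + 1 - j))"

definition KBLS :: "nat \<Rightarrow> nat \<Rightarrow> (nat \<times> nat \<Rightarrow> nat \<times> nat) set" where
  "KBLS m n = generate (BijGroup (kb_verts m n)) {kb_U m n, kb_H m n, kb_F m n}"

definition kb_act ::
    "nat \<Rightarrow> nat \<Rightarrow> (nat \<times> nat \<Rightarrow> nat \<times> nat) \<Rightarrow> (nat \<times> nat \<Rightarrow> nat) \<Rightarrow> (nat \<times> nat \<Rightarrow> nat)" where
  "kb_act m n A X = (\<lambda>v\<in>kb_verts m n. X (A v))"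

definition kb_equiv :: "nat \<Rightarrow> nat \<Rightarrow> (nat \<times> nat \<Rightarrow> nat) rel" where
  "kb_equiv m n =
     {(X, X'). X \<in> kb_labelings m n \<and> X' \<in> kb_labelings m n \<and>
               (\<exists>A \<in> KBLS m n. X' = kb_act m n A X)}"

definition kb_num_nonequiv :: "nat \<Rightarrow> nat \<Rightarrow> nat" where
  "kb_num_nonequiv m n = card (kb_labelings m n // kb_equiv m n)"


lemma kb_col_self: "j \<in> {1..n} \<Longrightarrow> kb_col n j = j"
  by (cases "j = n") (auto simp: kb_col_def mod_if)

lemma kb_col_range: "n > 0 \<Longrightarrow> kb_col n j \<in> {1..n}"
  by (auto simp: kb_col_def Suc_le_eq)

lemma kb_col_Suc: "j \<in> {1..n} \<Longrightarrow> kb_col n (j + 1) = (if j = n then 1 else j + 1)"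
  by (auto simp: kb_col_def mod_if)

lemma kb_col_diff: "j \<in> {1..n} \<Longrightarrow> kb_col n (n - j) = (if j = n then n else n - j)"
  by (auto simp: kb_col_def mod_if)

lemma kb_row_edge:
  assumes "i \<in> {1..m}" "j \<in> {1..n}"
  shows "{(i, j), (i, kb_col n (j + 1))} \<in> kb_edges m n"
proof (cases "j = n")
  case True
  then show ?thesis
    using assms(1) kb_col_Suc[OF assms(2)] unfolding kb_edges_def by auto
next
  case False
  then have "j \<in> {1..n - 1}" using assms(2) by auto
  then have "{(i, j), (i, j + 1)} \<in> kb_edges m n"
    using assms(1) unfolding kb_edges_def by blast
  then show ?thesis using False kb_col_Suc[OF assms(2)] by simp
qed

lemma kb_face_cycle:
  assumes "m \<ge> 2" "n \<ge> 2" "f \<in> kb_faces m n"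
  shows "\<exists>a b c d. distinct [a, b, c, d] \<and> f = {a, b, c, d} \<and>
           {{a, b}, {b, c}, {c, d}, {d, a}} \<subseteq> kb_edges m n"
proof -
  consider (inner) i j where "i \<in> {1..m - 1}" "j \<in> {1..n}"
      "f = {(i, j), (i, kb_col n (j + 1)), (i + 1, j), (i + 1, kb_col n (j + 1))}"
    | (outer) j where "j \<in> {1..n}"
      "f = {(m, j), (m, kb_col n (j + 1)), (1, n + 1 - j), (1, kb_col n (n - j))}"
    using assms(3) unfolding kb_faces_def by blast
  then show ?thesis
  proof cases
    case inner
    define j' where "j' = kb_col n (j + 1)"
    have j': "j' \<in> {1..n}" "j' \<noteq> j"
      using kb_col_range[of n "j + 1"] kb_col_Suc[OF inner(2)] inner(2) assms
      by (auto simp: j'_def split: if_splits)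
    have col: "{(i, k), (i + 1, k)} \<in> kb_edges m n" if "k \<in> {1..n}" for k
      using that inner(1) unfolding kb_edges_def by blast
    have row: "{(k, j), (k, j')} \<in> kb_edges m n" if "k \<in> {1..m}" for k
      using kb_row_edge[OF that inner(2)] by (simp add: j'_def)
    have im: "i \<in> {1..m}" "i + 1 \<in> {1..m}" using inner(1) by auto
    have "distinct [(i, j), (i, j'), (i + 1, j'), (i + 1, j)]" using j'(2) by auto
    moreover have "f = {(i, j), (i, j'), (i + 1, j'), (i + 1, j)}"
      unfolding inner(3) j'_def by blast
    moreover have "{(i + 1, j'), (i + 1, j)} \<in> kb_edges m n" "{(i + 1, j), (i, j)} \<in> kb_edges m n"
      using row[OF im(2)] col[OF inner(2)] by (simp_all only: insert_commute)
    then have "{{(i, j), (i, j')}, {(i, j'), (i + 1, j')}, {(i + 1, j'), (i + 1, j)},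
        {(i + 1, j), (i, j)}} \<subseteq> kb_edges m n"
      using row[OF im(1)] col[OF j'(1)] by blast
    ultimately show ?thesis by blast
  next
    case outer
    define j' k k' where "j' = kb_col n (j + 1)" and "k = n + 1 - j" and "k' = kb_col n (n - j)"
    have j': "j' \<in> {1..n}" "j' \<noteq> j" "k \<in> {1..n}" "k' \<in> {1..n}" "k' \<noteq> k"
        "k' = n + 1 - j'" "k = kb_col n (k' + 1)"
      using kb_col_range[of n "j + 1"] kb_col_Suc[OF outer(1)] kb_col_diff[OF outer(1)]
        kb_col_range[of n "n - j"] kb_col_Suc[of k' n] outer(1) assms
      by (auto simp: j'_def k_def k'_def split: if_splits)
    have col: "{(m, l), (1, n + 1 - l)} \<in> kb_edges m n" if "l \<in> {1..n}" for l
      using that unfolding kb_edges_def by blast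
    have row: "{(m, j), (m, j')} \<in> kb_edges m n" "{(1, k'), (1, k)} \<in> kb_edges m n"
      using kb_row_edge[of m m j n] kb_row_edge[of 1 m k' n] outer(1) assms(1) j'
      by (auto simp: j'_def)
    have "distinct [(m, j), (m, j'), (1, k'), (1, k)]" using j' assms(1) by auto
    moreover have "f = {(m, j), (m, j'), (1, k'), (1, k)}"
      unfolding outer(2) j'_def k_def k'_def by blast
    moreover have "{(m, j'), (1, k')} \<in> kb_edges m n"
      using col[OF j'(1)] j'(6) by simp
    moreover have "{(1, k), (m, j)} \<in> kb_edges m n"
      using col[OF outer(1)] unfolding k_def by (simp only: insert_commute)
    ultimately have "distinct [(m, j), (m, j'), (1, k'), (1, k)] \<and>
        f = {(m, j), (m, j'), (1, k'), (1, k)} \<and>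
        {{(m, j), (m, j')}, {(m, j'), (1, k')}, {(1, k'), (1, k)}, {(1, k), (m, j)}}
          \<subseteq> kb_edges m n"
      using row by blast
    then show ?thesis by blast
  qed
qed

lemma kb_generators_Bij:
  assumes "m \<ge> 1" "n \<ge> 1"
  shows "{kb_U m n, kb_H m n, kb_F m n} \<subseteq> Bij (kb_verts m n)"
proof -
  have fin: "finite (kb_verts m n)" by (simp add: kb_verts_def)
  have bij: "f \<in> Bij (kb_verts m n)"
    if "f \<in> extensional (kb_verts m n)" "f ` kb_verts m n \<subseteq> kb_verts m n"
      "inj_on f (kb_verts m n)" for f
    using that endo_inj_surj[OF fin that(2,3)] by (simp add: Bij_def bij_betw_def)
  have U: "kb_U m n \<in> Bij (kb_verts m n)"
    by (rule bij) (auto simp: kb_U_def kb_verts_def inj_on_def split: if_splits)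
  have F: "kb_F m n \<in> Bij (kb_verts m n)"
    by (rule bij) (auto simp: kb_F_def kb_verts_def inj_on_def)
  have inj: "a = b" if "a \<in> {1..n}" "b \<in> {1..n}"
    "kb_col n (a + n div 2) = kb_col n (b + n div 2)" for a b
  proof -
    have *: "x + n div 2 + n - 1 = x + (n div 2 + n - 1)" if "x \<ge> 1" for x
      using assms by simp
    have "(a + (n div 2 + n - 1)) mod n = (b + (n div 2 + n - 1)) mod n"
      using that *[of a] *[of b] by (simp add: kb_col_def)
    moreover have "y = x" if "(x + c) mod n = (y + c) mod n" "x \<le> y" "1 \<le> x" "y \<le> n" for x y c
    proof -
      have "n dvd (y + c) - (x + c)"
        using that(1,2) mod_eq_dvd_iff_nat[of "x + c" "y + c" n] by simp
      then have "n dvd y - x" by simp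
      then show ?thesis using that(2-4) by (cases "y = x") (auto dest!: dvd_imp_le)
    qed
    ultimately show ?thesis
      using that(1,2) by (metis atLeastAtMost_iff nat_le_linear)
  qed
  have H: "kb_H m n \<in> Bij (kb_verts m n)"
  proof (rule bij)
    show "kb_H m n ` kb_verts m n \<subseteq> kb_verts m n"
      using kb_col_range[of n] assms by (auto simp: kb_H_def kb_verts_def)
    show "inj_on (kb_H m n) (kb_verts m n)"
      using inj by (auto simp: kb_H_def kb_verts_def inj_on_def)
  qed (simp add: kb_H_def)
  from U F H show ?thesis by simp
qed

lemma equiv_kb_equiv:
  assumes "m \<ge> 1" "n \<ge> 1"
  shows "equiv (kb_labelings m n) (kb_equiv m n)"
proof -
  let ?V = "kb_verts m n"
  let ?G = "BijGroup ?V"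
  interpret G: group ?G by (rule group_BijGroup)
  have gen: "{kb_U m n, kb_H m n, kb_F m n} \<subseteq> carrier ?G"
    using kb_generators_Bij[OF assms] by (simp add: BijGroup_def)
  have sub: "subgroup (KBLS m n) ?G"
    unfolding KBLS_def by (rule G.generate_is_subgroup[OF gen])
  have Bij: "A \<in> Bij ?V" if "A \<in> KBLS m n" for A
    using subgroup.mem_carrier[OF sub that] by (simp add: BijGroup_def)
  have refl: "kb_act m n \<one>\<^bsub>?G\<^esub> X = X" if "X \<in> kb_labelings m n" for X
    using that by (auto simp: kb_act_def BijGroup_def kb_labelings_def extensional_def)
  have comp: "kb_act m n B (kb_act m n A X) = kb_act m n (A \<otimes>\<^bsub>?G\<^esub> B) X"
    if "A \<in> KBLS m n" "B \<in> KBLS m n" for A B X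
    using Bij[OF that(1)] Bij[OF that(2)] Bij_imp_funcset[OF Bij[OF that(2)]]
    by (auto simp: kb_act_def BijGroup_def compose_def fun_eq_iff restrict_def Pi_iff)
  show ?thesis
  proof (rule equivI)
    show "kb_equiv m n \<subseteq> kb_labelings m n \<times> kb_labelings m n"
      by (auto simp: kb_equiv_def)
    show "refl_on (kb_labelings m n) (kb_equiv m n)"
      using refl subgroup.one_closed[OF sub]
      by (force simp: refl_on_def kb_equiv_def)
    show "sym (kb_equiv m n)"
    proof (rule symI)
      fix X Y assume "(X, Y) \<in> kb_equiv m n"
      then obtain A where A: "A \<in> KBLS m n" "Y = kb_act m n A X"
        and XY: "X \<in> kb_labelings m n" "Y \<in> kb_labelings m n" by (auto simp: kb_equiv_def)
      have i: "inv\<^bsub>?G\<^esub> A \<in> KBLS m n" using A(1) sub by (rule subgroup.m_inv_closed[rotated])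
      have "X = kb_act m n (inv\<^bsub>?G\<^esub> A) Y"
        using comp[OF A(1) i, of X] A refl[OF XY(1)] subgroup.mem_carrier[OF sub A(1)] by simp
      then show "(Y, X) \<in> kb_equiv m n" using i XY by (auto simp: kb_equiv_def)
    qed
    show "trans (kb_equiv m n)"
    proof (rule transI)
      fix X Y Z assume "(X, Y) \<in> kb_equiv m n" "(Y, Z) \<in> kb_equiv m n"
      then show "(X, Z) \<in> kb_equiv m n"
        using comp subgroup.m_closed[OF sub] by (fastforce simp: kb_equiv_def)
    qed
  qed
qed

end

theory Submission
  imports Defs "HOL-Combinatorics.Permutations"
begin

text \<open>
  Put \<open>k = n / 2\<close>. For integers \<open>B\<^sub>1, \<dots>, B\<^sub>k\<close>, extended by \<open>B\<^sub>j = B\<^bsub>n+1-j\<^esub>\<close>, and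
  \<open>C\<^sub>1, \<dots>, C\<^sub>m\<close>, the array \<open>x\<^sub>i\<^sub>j = (m n + 1 + (-1)\<^bsup>i+j\<^esup> (B\<^sub>j + C\<^sub>i)) / 2\<close> has constant face
  sums because \<open>m\<close> is odd and \<open>n\<close> is even, and it is a labeling as soon as the numbers
  \<open>\<bar>B\<^sub>j + C\<^sub>i\<bar>\<close> are \<open>1, 3, \<dots>, m n - 1\<close> in some order. Whenever \<open>d\<close> divides \<open>2 m\<close>, the odd
  integers in \<open>(- m n, m n)\<close> are tiled by translates of the symmetric progression
  \<open>{d (2 q - k - 1) | 1 \<le> q \<le> k}\<close>, the set of translations being symmetric and free of \<open>0\<close>.
  Let \<open>B\<close> enumerate the progression, and let \<open>C\<close> enumerate the positive translations with
  arbitrary signs. The choices \<open>d = 1, 2, m, 2 m\<close> give \<open>4 k! m! 2\<^sup>m\<close> distinct labelings.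
  Since \<open>F = U\<^sup>m\<close>, the symmetry group has at most \<open>4 m\<close> elements, and \<open>k! \<ge> 6\<close>.
\<close>

section \<open>Bounding the number of classes from below by the size of the largest class\<close>

lemma card_le_card_quotient_times:
  assumes "equiv A r" "finite A" "\<And>c. c \<in> A // r \<Longrightarrow> card c \<le> b"
  shows "card A \<le> card (A // r) * b"
proof -
  have "card A = card (\<Union>(A // r))"
    using Union_quotient[OF assms(1)] by simp
  also have "\<dots> \<le> (\<Sum>c\<in>A // r. card c)"
    by (rule card_Union_le_sum_card)
  also have "\<dots> \<le> card (A // r) * b"
    using sum_bounded_above[of "A // r" card b] assms(3) by simp
  finally show ?thesis .
qed

lemma finite_kb_labelings: "finite (kb_labelings m n)"
proof (rule finite_subset)
  show "kb_labelings m n \<subseteq> (\<Pi>\<^sub>E v\<in>kb_verts m n. {1..m * n})"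
    unfolding kb_labelings_def PiE_def by (auto dest: bij_betwE)
  show "finite (\<Pi>\<^sub>E v\<in>kb_verts m n. {1..m * n})"
    by (intro finite_PiE) (auto simp: kb_verts_def)
qed

section \<open>The symmetry group and its order\<close>

lemma kb_U_apply:
  "(i, j) \<in> kb_verts m n \<Longrightarrow> kb_U m n (i, j) = (if i < m then (i + 1, j) else (1, n + 1 - j))"
  by (simp add: kb_U_def)

lemma kb_U_funpow_inner:
  assumes "(i, j) \<in> kb_verts m n" "i + a \<le> m"
  shows "(kb_U m n ^^ a) (i, j) = (i + a, j)"
  using assms(2)
proof (induction a)
  case (Suc a)
  then have "kb_U m n (i + a, j) = (i + a + 1, j)"
    using assms(1) by (subst kb_U_apply) (auto simp: kb_verts_def)
  then show ?case using Suc by simp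
qed simp

text \<open>Starting in row \<open>i\<close>, \<open>m - i\<close> steps climb to row
  \<open>m\<close>, one step crosses the seam and reflects the column, and \<open>i - 1\<close>
  further steps return to row \<open>i\<close>. The seam is crossed exactly once.\<close>

lemma kb_U_funpow_m:
  assumes "(i, j) \<in> kb_verts m n"
  shows "(kb_U m n ^^ m) (i, j) = (i, n + 1 - j)"
proof -
  have i: "1 \<le> i" "i \<le> m" "1 \<le> j" "j \<le> n" using assms by (auto simp: kb_verts_def)
  then have "m = (i - 1) + (Suc (m - i))" by simp
  then have "(kb_U m n ^^ m) (i, j) = (kb_U m n ^^ (i - 1)) (kb_U m n ((kb_U m n ^^ (m - i)) (i, j)))"
    by (metis comp_apply funpow.simps(2) funpow_add)
  also have "\<dots> = (kb_U m n ^^ (i - 1)) (1, n + 1 - j)"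
    using i assms by (subst kb_U_funpow_inner) (auto simp: kb_U_apply kb_verts_def)
  also have "\<dots> = (i, n + 1 - j)"
    using i by (subst kb_U_funpow_inner) (auto simp: kb_verts_def)
  finally show ?thesis .
qed

lemma kb_col_half:
  assumes "even n" "j \<in> {1..n}"
  shows "kb_col n (j + n div 2) = (if j \<le> n div 2 then j + n div 2 else j - n div 2)"
proof -
  obtain k where k: "n = 2 * k" using assms(1) by blast
  have "(j + k + 2 * k - 1) mod (2 * k) = (if j \<le> k then j + k - 1 else j - k - 1)"
  proof (cases "j \<le> k")
    case True
    then have "j + k + 2 * k - 1 = (j + k - 1) + 2 * k" using assms by auto
    then show ?thesis using True assms k by (simp only: mod_add_self2) (simp add: k)
  next
    case False
    then have "j + k + 2 * k - 1 = (j - k - 1) + 2 * k * 2" using assms by auto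
    then show ?thesis using False assms k by (simp only: mod_mult_self2) (simp add: k)
  qed
  then show ?thesis using assms k by (auto simp: kb_col_def)
qed

text \<open>The generators commute: \<open>F\<close> is the \<open>m\<close>-th power of
  \<open>U\<close>, and \<open>U\<close> commutes with \<open>H\<close>. Since the powers
  \<open>2 * m\<close> of \<open>U\<close> and \<open>2\<close> of \<open>H\<close> are trivial,
  every element is a product of \<open>U\<close> to the \<open>a\<close> and \<open>H\<close> to the
  \<open>b\<close> with \<open>a < 2 * m\<close> and \<open>b < 2\<close>.\<close>

lemma card_KBLS_le:
  assumes "m \<ge> 1" "n \<ge> 1" "even n"
  shows "finite (KBLS m n)" "card (KBLS m n) \<le> 4 * m"
proof -
  let ?V = "kb_verts m n" let ?U = "kb_U m n" let ?H = "kb_H m n" let ?F = "kb_F m n"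
  define G where "G = BijGroup ?V"
  interpret G: group G unfolding G_def by (rule group_BijGroup)
  have Bij: "?U \<in> Bij ?V" "?H \<in> Bij ?V" "?F \<in> Bij ?V"
    using kb_generators_Bij[OF assms(1,2)] by auto
  have car: "?U \<in> carrier G" "?H \<in> carrier G" "?F \<in> carrier G"
    using Bij by (auto simp: G_def BijGroup_def)
  have mult: "f \<otimes>\<^bsub>G\<^esub> g = compose ?V f g" if "f \<in> carrier G" "g \<in> carrier G" for f g
    using that by (simp add: G_def BijGroup_def)
  have one: "\<one>\<^bsub>G\<^esub> = (\<lambda>v\<in>?V. v)" by (simp add: G_def BijGroup_def)
  have maps: "?U v \<in> ?V" "?H v \<in> ?V" if "v \<in> ?V" for v
    using that Bij_imp_funcset[OF Bij(1)] Bij_imp_funcset[OF Bij(2)] by auto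
  have pow: "?U [^]\<^bsub>G\<^esub> a = (\<lambda>v\<in>?V. (?U ^^ a) v)" for a :: nat
  proof (induction a)
    case (Suc a)
    have "?U [^]\<^bsub>G\<^esub> Suc a = compose ?V (?U [^]\<^bsub>G\<^esub> a) ?U"
      using mult[OF G.nat_pow_closed[OF car(1)] car(1)] by simp
    also have "\<dots> = (\<lambda>v\<in>?V. (?U ^^ Suc a) v)"
      unfolding Suc by (auto simp: compose_def restrict_def fun_eq_iff maps funpow_swap1)
    finally show ?case .
  qed (simp add: one)
  have Um: "?U [^]\<^bsub>G\<^esub> m = ?F"
    unfolding pow kb_F_def by (rule restrict_ext) (auto simp: kb_U_funpow_m)
  have FF: "?F \<otimes>\<^bsub>G\<^esub> ?F = \<one>\<^bsub>G\<^esub>"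
    unfolding mult[OF car(3) car(3)] one compose_def
    by (rule restrict_ext) (auto simp: kb_F_def kb_verts_def)
  have upper: "j - n div 2 \<le> n div 2" if "j \<le> n" for j using assms(3) that by presburger
  have HH: "?H \<otimes>\<^bsub>G\<^esub> ?H = \<one>\<^bsub>G\<^esub>"
    unfolding mult[OF car(2) car(2)] one compose_def
    using assms kb_col_range[of n]
    by (intro restrict_ext) (auto simp: kb_H_def kb_verts_def kb_col_half upper)
  have UH: "?U \<otimes>\<^bsub>G\<^esub> ?H = ?H \<otimes>\<^bsub>G\<^esub> ?U"
    unfolding mult[OF car(1) car(2)] mult[OF car(2) car(1)] compose_def
  proof (rule restrict_ext, clarify)
    fix i j assume v: "(i, j) \<in> ?V"
    then have j: "j \<in> {1..n}" "n + 1 - j \<in> {1..n}" by (auto simp: kb_verts_def)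
    define h where "h = kb_col n (j + n div 2)"
    have "h \<in> {1..n}" unfolding h_def using kb_col_range assms(2) by simp
    \<comment> \<open>Reflection turns the shift by \<open>n div 2\<close> into the shift by its
      negative, which is the same modulo \<open>n\<close>.\<close>
    moreover have "kb_col n (n + 1 - j + n div 2) = n + 1 - h"
      using j assms(3) unfolding h_def kb_col_half[OF assms(3) j(1)] kb_col_half[OF assms(3) j(2)]
      by (elim evenE) auto
    moreover have "?H (l, n + 1 - j) = (l, kb_col n (n + 1 - j + n div 2))"
      "?H (l, j) = (l, h)" if "l \<in> {1..m}" for l
      using that j by (auto simp: kb_H_def kb_verts_def h_def)
    ultimately show "?U (?H (i, j)) = ?H (?U (i, j))"
      using v by (auto simp: kb_U_apply kb_verts_def)
  qed
  have U2m: "?U [^]\<^bsub>G\<^esub> (2 * m) = \<one>\<^bsub>G\<^esub>"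
    using FF Um G.nat_pow_mult[OF car(1), of m m] by (simp add: mult_2)
  have H2: "?H [^]\<^bsub>G\<^esub> (2::nat) = \<one>\<^bsub>G\<^esub>"
    using HH car(2) by (simp add: numeral_2_eq_2)
  have pow_mod: "x [^]\<^bsub>G\<^esub> a = x [^]\<^bsub>G\<^esub> (a mod c)"
    if "x \<in> carrier G" "x [^]\<^bsub>G\<^esub> c = \<one>\<^bsub>G\<^esub>" for x and a c :: nat
  proof -
    have "x [^]\<^bsub>G\<^esub> a = x [^]\<^bsub>G\<^esub> (c * (a div c) + a mod c)" by simp
    also have "\<dots> = (x [^]\<^bsub>G\<^esub> c) [^]\<^bsub>G\<^esub> (a div c) \<otimes>\<^bsub>G\<^esub> x [^]\<^bsub>G\<^esub> (a mod c)"
      using that(1) by (simp only: G.nat_pow_mult[symmetric] G.nat_pow_pow)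
    finally show ?thesis using that by simp
  qed
  define g where "g = (\<lambda>(a::nat, b::nat). ?U [^]\<^bsub>G\<^esub> a \<otimes>\<^bsub>G\<^esub> ?H [^]\<^bsub>G\<^esub> b)"
  have g_mult: "g (a, b) \<otimes>\<^bsub>G\<^esub> g (a', b') = g (a + a', b + b')" for a b a' b'
  proof -
    have "?H [^]\<^bsub>G\<^esub> b \<otimes>\<^bsub>G\<^esub> ?U [^]\<^bsub>G\<^esub> a' = ?U [^]\<^bsub>G\<^esub> a' \<otimes>\<^bsub>G\<^esub> ?H [^]\<^bsub>G\<^esub> b"
      by (metis G.group_commutes_pow G.nat_pow_closed UH car(1) car(2))
    moreover have "(x \<otimes>\<^bsub>G\<^esub> y) \<otimes>\<^bsub>G\<^esub> (z \<otimes>\<^bsub>G\<^esub> w) = (x \<otimes>\<^bsub>G\<^esub> z) \<otimes>\<^bsub>G\<^esub> (y \<otimes>\<^bsub>G\<^esub> w)"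
      if "x \<in> carrier G" "y \<in> carrier G" "z \<in> carrier G" "w \<in> carrier G"
        "y \<otimes>\<^bsub>G\<^esub> z = z \<otimes>\<^bsub>G\<^esub> y" for x y z w
    proof -
      have "(x \<otimes>\<^bsub>G\<^esub> y) \<otimes>\<^bsub>G\<^esub> (z \<otimes>\<^bsub>G\<^esub> w) = x \<otimes>\<^bsub>G\<^esub> ((y \<otimes>\<^bsub>G\<^esub> z) \<otimes>\<^bsub>G\<^esub> w)"
        using that(1-4) by (simp add: G.m_assoc)
      then show ?thesis unfolding that(5) using that(1-4) by (simp add: G.m_assoc)
    qed
    ultimately show ?thesis
      using car unfolding g_def by (simp add: G.nat_pow_mult[symmetric])
  qed
  have "A \<in> range g" if "A \<in> KBLS m n" for A
    using that unfolding KBLS_def G_def[symmetric]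
  proof (induction rule: generate.induct)
    case one
    have "\<one>\<^bsub>G\<^esub> = g (0, 0)" by (simp add: g_def)
    then show ?case by blast
  next
    case (incl h)
    have "?U = g (1, 0)" "?H = g (0, 1)" "?F = g (m, 0)" using car Um by (auto simp: g_def)
    then show ?case using incl by blast
  next
    \<comment> \<open>Inverses are rewritten as natural powers, so that \<open>g\<close> needs no
      negative exponents.\<close>
    case (inv h)
    have "inv\<^bsub>G\<^esub> ?U = ?U [^]\<^bsub>G\<^esub> (2 * m - 1)"
    proof (rule G.inv_equality)
      show "?U [^]\<^bsub>G\<^esub> (2 * m - 1) \<otimes>\<^bsub>G\<^esub> ?U = \<one>\<^bsub>G\<^esub>"
        using U2m assms(1) G.nat_pow_Suc[of ?U "2 * m - 1"] by simp
    qed (use car in auto)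
    moreover have "inv\<^bsub>G\<^esub> ?H = ?H" "inv\<^bsub>G\<^esub> ?F = ?F"
      using HH FF car by (auto intro: G.inv_equality)
    ultimately have "inv\<^bsub>G\<^esub> ?U = g (2 * m - 1, 0)" "inv\<^bsub>G\<^esub> ?H = g (0, 1)" "inv\<^bsub>G\<^esub> ?F = g (m, 0)"
      using car Um by (auto simp: g_def)
    then show ?case using inv by blast
  next
    case (eng h1 h2)
    then show ?case using g_mult by (metis (no_types, lifting) imageE prod.exhaust rangeI)
  qed
  moreover have "g p \<in> g ` ({..<2 * m} \<times> {..<2})" for p
  proof -
    obtain a b where p: "p = (a, b)" by (cases p)
    have "g (a, b) = g (a mod (2 * m), b mod 2)"
      using pow_mod[OF car(1) U2m, of a] pow_mod[OF car(2) H2, of b] by (simp add: g_def)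
    then show ?thesis using assms(1) p by auto
  qed
  ultimately have sub: "KBLS m n \<subseteq> g ` ({..<2 * m} \<times> {..<2})" by blast
  then show "finite (KBLS m n)" by (rule finite_subset) simp
  have "card (KBLS m n) \<le> card ({..<2 * m} \<times> {..<2::nat})"
    using surj_card_le[OF _ sub] by simp
  then show "card (KBLS m n) \<le> 4 * m" by simp
qed

text \<open>The class of \<open>X\<close> lies in the orbit of \<open>X\<close>, an image of
  \<open>KBLS m n\<close>, so it has at most \<open>4 * m\<close> elements.\<close>

lemma card_kb_labelings_le:
  assumes "m \<ge> 1" "n \<ge> 1" "even n"
  shows "card (kb_labelings m n) \<le> kb_num_nonequiv m n * (4 * m)"
  unfolding kb_num_nonequiv_def
proof (rule card_le_card_quotient_times[OF equiv_kb_equiv finite_kb_labelings])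
  fix c assume "c \<in> kb_labelings m n // kb_equiv m n"
  then obtain X where "c = kb_equiv m n `` {X}" by (auto elim: quotientE)
  then have "c \<subseteq> (\<lambda>A. kb_act m n A X) ` KBLS m n" by (auto simp: kb_equiv_def)
  then have "card c \<le> card (KBLS m n)"
    using card_KBLS_le(1)[OF assms] by (rule surj_card_le[rotated])
  then show "card c \<le> 4 * m" using card_KBLS_le(2)[OF assms] by simp
qed (use assms in auto)

section \<open>Labelings built from signed sums\<close>

definition kb_fold :: "nat \<Rightarrow> nat \<Rightarrow> nat" where
  "kb_fold n j = (if j \<le> n div 2 then j else n + 1 - j)"

text \<open>Under the assumptions of the locale below neither \<open>nat\<close> nor
  \<open>div 2\<close> truncates anything; \<open>two_checker\<close> is the exact form used from
  then on.\<close>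

definition kb_checker :: "nat \<Rightarrow> nat \<Rightarrow> (nat \<Rightarrow> int) \<Rightarrow> (nat \<Rightarrow> int) \<Rightarrow> nat \<times> nat \<Rightarrow> nat" where
  "kb_checker m n B C = (\<lambda>(i, j)\<in>kb_verts m n.
     nat ((int (m * n) + 1 + (-1) ^ (i + j) * (B (kb_fold n j) + C i)) div 2))"

text \<open>There are \<open>m * (n div 2)\<close> pairs \<open>(i, j)\<close>, as many as there are
  odd numbers between \<open>0\<close> and \<open>m * n\<close>. Hence the assumptions force the
  absolute values to be exactly \<open>1, 3, ..., m * n - 1\<close>.\<close>

locale kb_signed_sums =
  fixes m n :: nat and B C :: "nat \<Rightarrow> int"
  assumes m: "odd m" "m \<ge> 2" and n: "even n" "n \<ge> 2"
    and odd_sum: "\<lbrakk>i \<in> {1..m}; j \<in> {1..n div 2}\<rbrakk> \<Longrightarrow> odd (B j + C i)"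
    and sum_bound: "\<lbrakk>i \<in> {1..m}; j \<in> {1..n div 2}\<rbrakk> \<Longrightarrow> \<bar>B j + C i\<bar> < int (m * n)"
    and abs_inj: "\<lbrakk>i \<in> {1..m}; j \<in> {1..n div 2}; i' \<in> {1..m}; j' \<in> {1..n div 2};
      \<bar>B j + C i\<bar> = \<bar>B j' + C i'\<bar>\<rbrakk> \<Longrightarrow> i = i' \<and> j = j'"
begin

lemma fold_range: "j \<in> {1..n} \<Longrightarrow> kb_fold n j \<in> {1..n div 2}"
  using n by (auto simp: kb_fold_def elim!: evenE)

lemma two_checker:
  assumes "i \<in> {1..m}" "j \<in> {1..n}"
  shows "2 * int (kb_checker m n B C (i, j)) =
    int (m * n) + 1 + (-1) ^ (i + j) * (B (kb_fold n j) + C i)"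
proof -
  let ?z = "(-1) ^ (i + j) * (B (kb_fold n j) + C i)"
  have z: "odd ?z" "\<bar>?z\<bar> < int (m * n)"
    using odd_sum[OF assms(1) fold_range[OF assms(2)]] sum_bound[OF assms(1) fold_range[OF assms(2)]]
    by (auto simp: abs_mult)
  moreover have "even (int (m * n))" using n(1) by simp
  ultimately have "even (int (m * n) + 1 + ?z)" by simp
  moreover have "int (m * n) + 1 + ?z \<ge> 0" using z by linarith
  ultimately show ?thesis
    using assms unfolding kb_checker_def by (simp add: kb_verts_def)
qed

lemma checker_range:
  assumes "i \<in> {1..m}" "j \<in> {1..n}"
  shows "kb_checker m n B C (i, j) \<in> {1..m * n}"
proof -
  have "\<bar>(-1) ^ (i + j) * (B (kb_fold n j) + C i)\<bar> < int (m * n)"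
    using sum_bound[OF assms(1) fold_range[OF assms(2)]] by (simp add: abs_mult)
  then have "0 < 2 * int (kb_checker m n B C (i, j))"
     "2 * int (kb_checker m n B C (i, j)) \<le> 2 * int (m * n)"
    using two_checker[OF assms] by linarith+
  then show ?thesis by (simp del: of_nat_mult)
qed

text \<open>Up to sign, twice the label minus \<open>m * n + 1\<close> is \<open>B j + C i\<close>,
  so a label determines the row and the folded column. Two different columns with the same fold add
  up to the odd number \<open>n + 1\<close>; they carry opposite signs, and an odd sum is not its
  own negative.\<close>

lemma inj_on_checker: "inj_on (kb_checker m n B C) (kb_verts m n)"
proof (rule inj_onI, clarify)
  fix i j i' j' assume v: "(i, j) \<in> kb_verts m n" "(i', j') \<in> kb_verts m n"
    and eq: "kb_checker m n B C (i, j) = kb_checker m n B C (i', j')"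
  have ij: "i \<in> {1..m}" "j \<in> {1..n}" "i' \<in> {1..m}" "j' \<in> {1..n}"
    using v by (auto simp: kb_verts_def)
  have s: "(-1) ^ (i + j) * (B (kb_fold n j) + C i) = (-1) ^ (i' + j') * (B (kb_fold n j') + C i')"
    using two_checker[OF ij(1,2)] two_checker[OF ij(3,4)] eq by simp
  then have "\<bar>B (kb_fold n j) + C i\<bar> = \<bar>B (kb_fold n j') + C i'\<bar>"
    by (metis abs_mult abs_neg_one power_abs power_one mult_1)
  then have f: "i = i'" "kb_fold n j = kb_fold n j'"
    using abs_inj[OF ij(1) fold_range[OF ij(2)] ij(3) fold_range[OF ij(4)]] by auto
  have "j = j'"
  proof (rule ccontr)
    assume "j \<noteq> j'"
    then have "j + j' = n + 1" using f(2) ij by (auto simp: kb_fold_def split: if_splits)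
    then have "odd (j + j')" using n by simp
    then have "(-1) ^ (i + j) = - ((-1) ^ (i' + j') :: int)"
      using f(1) by (simp add: minus_one_power_iff)
    then have "B (kb_fold n j) + C i = 0"
      using s f by (simp add: minus_one_power_iff split: if_splits)
    then show False using odd_sum[OF ij(1) fold_range[OF ij(2)]] by simp
  qed
  with f show "i = i' \<and> j = j'" by simp
qed

text \<open>Neighbouring columns carry opposite signs, also across the wrap from \<open>n\<close> to
  \<open>1\<close> because \<open>n\<close> is even. Thus \<open>C i\<close> cancels and only a
  difference of \<open>B\<close> values remains.\<close>

lemma checker_row_pair:
  assumes "i \<in> {1..m}" "j \<in> {1..n}"
  shows "2 * (int (kb_checker m n B C (i, j)) + int (kb_checker m n B C (i, kb_col n (j + 1)))) =
    2 * (int (m * n) + 1) + (-1) ^ (i + j) * (B (kb_fold n j) - B (kb_fold n (kb_col n (j + 1))))"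
proof -
  have "kb_col n (j + 1) \<in> {1..n}" using kb_col_range n by simp
  moreover have "(-1) ^ (i + kb_col n (j + 1)) = - ((-1) ^ (i + j) :: int)"
    using n kb_col_Suc[OF assms(2)] by (auto simp: minus_one_power_iff)
  ultimately show ?thesis
    using two_checker[OF assms] two_checker[OF assms(1), of "kb_col n (j + 1)"]
    by (simp add: algebra_simps)
qed

text \<open>A face consists of two row pairs. Inside the grid the rows \<open>i\<close> and
  \<open>i + 1\<close> have opposite signs, so the differences of \<open>B\<close> cancel. Across
  the seam the column reflection reverses the difference, while \<open>m\<close> odd makes the two
  signs agree, so they cancel again.\<close>

lemma checker_labeling: "kb_checker m n B C \<in> kb_labelings m n"
proof -
  let ?X = "kb_checker m n B C"
  have "?X ` kb_verts m n \<subseteq> {1..m * n}"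
    using checker_range by (auto simp: kb_verts_def simp del: atLeastAtMost_iff)
  then have "?X ` kb_verts m n = {1..m * n}"
    by (rule card_subset_eq[rotated])
      (simp_all add: card_image[OF inj_on_checker], simp add: kb_verts_def)
  then have bij: "bij_betw ?X (kb_verts m n) {1..m * n}"
    using inj_on_checker by (simp add: bij_betw_def)
  have half: "s = 2 * (p + 1)" if "2 * int s = 4 * (int p + 1)" for s p
    using that by presburger
  have "(\<Sum>v\<in>f. ?X v) = 2 * (m * n + 1)" if f: "f \<in> kb_faces m n" for f
  proof -
    consider (inner) i j where "i \<in> {1..m - 1}" "j \<in> {1..n}"
        "f = {(i, j), (i, kb_col n (j + 1)), (i + 1, j), (i + 1, kb_col n (j + 1))}"
      | (outer) j where "j \<in> {1..n}"
        "f = {(m, j), (m, kb_col n (j + 1)), (1, n + 1 - j), (1, kb_col n (n - j))}"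
      using f unfolding kb_faces_def by blast
    then show ?thesis
    proof cases
      case inner
      have i: "i \<in> {1..m}" "i + 1 \<in> {1..m}" using inner by auto
      have "j \<noteq> kb_col n (j + 1)" using kb_col_Suc[OF inner(2)] n by auto
      then have "(\<Sum>v\<in>f. ?X v) = ?X (i, j) + ?X (i, kb_col n (j + 1)) +
          (?X (i + 1, j) + ?X (i + 1, kb_col n (j + 1)))"
        unfolding inner(3) by simp
      moreover have "2 * int \<dots> = 4 * (int (m * n) + 1)"
        using checker_row_pair[OF i(1) inner(2)] checker_row_pair[OF i(2) inner(2)] by simp
      ultimately have "2 * int (\<Sum>v\<in>f. ?X v) = 4 * (int (m * n) + 1)" by presburger
      then show ?thesis by (rule half)
    next
      case outer
      define j' where "j' = kb_col n (n - j)"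
      have j': "j' \<in> {1..n}" "kb_col n (j' + 1) = n + 1 - j" "j' \<noteq> n + 1 - j"
          "kb_col n (j + 1) = n + 1 - j'"
        using kb_col_range[of n "n - j"] kb_col_Suc[of j' n] kb_col_Suc[OF outer(1)]
          kb_col_diff[OF outer(1)] outer(1) n
        by (auto simp: j'_def split: if_splits)
      have fold: "kb_fold n (n + 1 - l) = kb_fold n l" if "l \<in> {1..n}" for l
        using that n(1) by (auto simp: kb_fold_def elim!: evenE)
      \<comment> \<open>Here \<open>j'\<close> is \<open>n - j\<close>, or \<open>n\<close> when
        \<open>j = n\<close>; so \<open>j + j'\<close> is \<open>n\<close> or \<open>2 * n\<close>,
        even in both cases.\<close>
      have "odd (j + j') = odd (n + n)"
        using kb_col_diff[OF outer(1)] outer(1) n(1) by (auto simp: j'_def)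
      then have sgn: "(-1) ^ (m + j) = ((-1) ^ (1 + j') :: int)"
        using m(1) by (auto simp: minus_one_power_iff)
      have "j \<noteq> kb_col n (j + 1)" "m \<noteq> 1" using kb_col_Suc[OF outer(1)] n m by auto
      then have "(\<Sum>v\<in>f. ?X v) = ?X (m, j) + ?X (m, kb_col n (j + 1)) +
          (?X (1, j') + ?X (1, kb_col n (j' + 1)))"
        using j'(3) unfolding outer(2) j'_def[symmetric] j'(2) by simp
      moreover have "2 * int \<dots> = 4 * (int (m * n) + 1)"
      proof -
        have "m \<in> {1..m}" "1 \<in> {1..m}" using m by auto
        from checker_row_pair[OF this(1) outer(1)] checker_row_pair[OF this(2) j'(1)]
        show ?thesis
          unfolding j'(2,4) fold[OF outer(1)] fold[OF j'(1)] sgn by (simp add: algebra_simps)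
      qed
      ultimately have "2 * int (\<Sum>v\<in>f. ?X v) = 4 * (int (m * n) + 1)" by presburger
      then show ?thesis by (rule half)
    qed
  qed
  with bij show ?thesis
    unfolding kb_labelings_def by (auto simp: kb_checker_def)
qed

end


section \<open>Tiling the odd integers by translates of a progression\<close>

definition tile_row :: "nat \<Rightarrow> nat \<Rightarrow> nat \<Rightarrow> int" where
  "tile_row k d q = int d * (2 * int q - int k - 1)"

text \<open>The translation with index \<open>(r, t)\<close>, meant for \<open>r < d\<close> and
  \<open>t < e\<close>. The constants are chosen so that adding \<open>tile_row k d q\<close> gives
  \<open>2 * w + 1 - d * k * e\<close>, where \<open>w\<close> has the mixed-radix digits
  \<open>r\<close>, \<open>q - 1\<close>, \<open>t\<close> for the radices \<open>d\<close>,
  \<open>k\<close>, \<open>e\<close>.\<close>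

definition tile_col :: "nat \<Rightarrow> nat \<Rightarrow> nat \<Rightarrow> nat \<times> nat \<Rightarrow> int" where
  "tile_col k d e = (\<lambda>(r, t).
     2 * int r + 2 * int (d * k * t) + int d * (int k - 1) + 1 - int (d * k * e))"

lemma tile_row_reflect: "q \<le> k \<Longrightarrow> tile_row k d (k + 1 - q) = - tile_row k d q"
  by (simp add: tile_row_def of_nat_diff algebra_simps)

lemma tile_col_reflect:
  "r < d \<Longrightarrow> t < e \<Longrightarrow> tile_col k d e (d - 1 - r, e - 1 - t) = - tile_col k d e (r, t)"
  by (simp add: tile_col_def of_nat_diff algebra_simps)

text \<open>As the digits vary, \<open>w\<close> runs once through the numbers below
  \<open>d * k * e\<close>, so the sums run once through the odd or even integers of the parity of
  \<open>d * k * e + 1\<close> in a symmetric window.\<close>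

lemma tile_sum:
  assumes "q \<in> {1..k}"
  shows "tile_row k d q + tile_col k d e (r, t) =
    2 * int (r + d * (q - 1 + k * t)) + 1 - int (d * k * e)"
proof -
  obtain q' where "q = Suc q'" using assms by (cases q) auto
  then show ?thesis by (simp add: tile_row_def tile_col_def algebra_simps)
qed

lemma mixed_radix_bound:
  fixes r d q k t e :: nat
  assumes "r < d" "q < k" "t < e"
  shows "r + d * (q + k * t) < d * k * e"
proof -
  have "q + k * t < k * e"
    using assms(2,3) mult_le_mono2[of "Suc t" e k] by simp
  then have "d * Suc (q + k * t) \<le> d * (k * e)" by (intro mult_le_mono2) simp
  then show ?thesis using assms(1) by (simp add: mult.assoc)
qed

lemma mixed_radix_inj:
  fixes r d q k t :: nat
  assumes "r < d" "q < k" "r' < d" "q' < k"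
    and eq: "r + d * (q + k * t) = r' + d * (q' + k * t')"
  shows "r = r' \<and> q = q' \<and> t = t'"
proof -
  have "(r + d * (q + k * t)) mod d = (r' + d * (q' + k * t')) mod d" using eq by (rule arg_cong)
  then have r: "r = r'" using assms(1,3) by (simp only: mod_mult_self2 mod_less)
  then have *: "q + k * t = q' + k * t'" using eq assms by simp
  then have "(q + k * t) mod k = (q' + k * t') mod k" by (rule arg_cong)
  then have "q = q'" using assms(2,4) by (simp only: mod_mult_self2 mod_less)
  then show ?thesis using r * assms by simp
qed

lemma tile_sum_inj:
  assumes "q \<in> {1..k}" "q' \<in> {1..k}" "p \<in> {..<d} \<times> {..<e}" "p' \<in> {..<d} \<times> {..<e}"
    and "tile_row k d q + tile_col k d e p = tile_row k d q' + tile_col k d e p'"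
  shows "q = q' \<and> p = p'"
proof -
  obtain r t r' t' where p: "p = (r, t)" "p' = (r', t')" by (cases p, cases p')
  have "r + d * (q - 1 + k * t) = r' + d * (q' - 1 + k * t')"
    using assms(5) unfolding p tile_sum[OF assms(1)] tile_sum[OF assms(2)]
    by (simp del: of_nat_add of_nat_mult)
  then show ?thesis
    using mixed_radix_inj[of r d "q - 1" k r' "q' - 1" t t'] assms p by auto
qed

text \<open>The set \<open>D\<close> of all \<open>d * e = 2 * m\<close> translations is closed
  under negation and avoids \<open>0\<close>, so exactly \<open>m\<close> of them are positive;
  \<open>c\<close> enumerates these.\<close>

lemma positive_tile_col:
  assumes "d * e = 2 * m" "k \<ge> 1" "m \<ge> 1"
  obtains c where "\<And>i. i \<in> {1..m} \<Longrightarrow> 0 < c i"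
    and "\<And>i q. i \<in> {1..m} \<Longrightarrow> q \<in> {1..k} \<Longrightarrow>
      odd (tile_row k d q + c i) \<and> \<bar>tile_row k d q + c i\<bar> < int (2 * m * k)"
    and "\<And>i q i' q'. \<lbrakk>i \<in> {1..m}; q \<in> {1..k}; i' \<in> {1..m}; q' \<in> {1..k};
      \<bar>tile_row k d q + c i\<bar> = \<bar>tile_row k d q' + c i'\<bar>\<rbrakk> \<Longrightarrow> i = i' \<and> q = q'"
proof -
  let ?I = "{..<d} \<times> {..<e}"
  define D where "D = tile_col k d e ` ?I"
  define P where "P = {y \<in> D. 0 < y}"
  have inj: "inj_on (tile_col k d e) ?I"
    using tile_sum_inj[of 1 k 1 _ d e] assms(2) by (intro inj_onI) force
  have neg: "- y \<in> D" if y: "y \<in> D" for y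
  proof -
    obtain r t where rt: "r < d" "t < e" "y = tile_col k d e (r, t)"
      using y by (auto simp: D_def)
    then show ?thesis unfolding D_def
      by (intro image_eqI[of _ _ "(d - 1 - r, e - 1 - t)"]) (auto simp: tile_col_reflect[symmetric])
  qed
  \<comment> \<open>A zero translation would be fixed by the reflection of \<open>(r, t)\<close>,
    making \<open>d\<close> and \<open>e\<close> both odd, although \<open>d * e\<close> is
    even.\<close>
  have nz: "0 \<notin> D"
  proof
    assume "0 \<in> D"
    then obtain r t where rt: "r < d" "t < e" "tile_col k d e (r, t) = 0" by (auto simp: D_def)
    then have "tile_col k d e (d - 1 - r, e - 1 - t) = tile_col k d e (r, t)"
      using tile_col_reflect[of r d t e k] by simp
    then have "(d - 1 - r, e - 1 - t) = (r, t)" using rt by (intro inj_onD[OF inj]) auto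
    then have "d = 2 * r + 1" "e = 2 * t + 1" using rt by auto
    then have "odd (d * e)" by simp
    then show False using assms(1) by simp
  qed
  have fin: "finite D" by (simp add: D_def)
  have "D = P \<union> uminus ` P"
  proof (intro equalityI subsetI)
    fix y assume y: "y \<in> D"
    then have "y \<noteq> 0" using nz by auto
    then show "y \<in> P \<union> uminus ` P"
      using y neg[OF y] by (cases "0 < y") (auto simp: P_def intro!: image_eqI[of _ _ "- y"])
  qed (use neg in \<open>auto simp: P_def\<close>)
  moreover have "P \<inter> uminus ` P = {}" by (auto simp: P_def)
  moreover have "card (uminus ` P) = card P" by (intro card_image) (auto simp: inj_on_def)
  moreover have "finite P" using fin by (simp add: P_def)
  ultimately have "card D = 2 * card P" by (simp add: card_Un_disjoint)
  then have "card P = m" using card_image[OF inj] assms(1) by (simp add: D_def)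
  then obtain c where c: "bij_betw c {1..m} P"
    using \<open>finite P\<close> finite_same_card_bij[of "{1..m}" P] by auto
  have cP: "c i \<in> P" if "i \<in> {1..m}" for i using c that by (rule bij_betwE[THEN bspec])
  have uniq: "q = q' \<and> y = y'"
    if "q \<in> {1..k}" "q' \<in> {1..k}" "y \<in> D" "y' \<in> D" "tile_row k d q + y = tile_row k d q' + y'"
    for q q' y y'
    using that tile_sum_inj[of q k q' _ d e] unfolding D_def by (auto simp del: atLeastAtMost_iff)
  have centered: "\<bar>2 * int w + 1 - int N\<bar> < int N" if "w < N" for w N :: nat
    using that by linarith
  show thesis
  proof (rule that)
    fix i q assume i: "i \<in> {1..m}" and q: "q \<in> {1..k}"
    obtain r t where rt: "r < d" "t < e" "c i = tile_col k d e (r, t)"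
      using cP[OF i] by (auto simp: P_def D_def)
    have dke: "d * k * e = 2 * m * k" using assms(1) by (metis mult.commute mult.left_commute)
    let ?w = "r + d * (q - 1 + k * t)"
    have eq: "tile_row k d q + c i = 2 * int ?w + 1 - int (2 * m * k)"
      using tile_sum[OF q, of d e r t] unfolding rt(3) dke .
    have "?w < 2 * m * k" using mixed_radix_bound[of r d "q - 1" k t e] q rt dke by auto
    then have "\<bar>2 * int ?w + 1 - int (2 * m * k)\<bar> < int (2 * m * k)" by (rule centered)
    then show "odd (tile_row k d q + c i) \<and> \<bar>tile_row k d q + c i\<bar> < int (2 * m * k)"
      unfolding eq by simp
  next
    fix i q i' q'
    assume i: "i \<in> {1..m}" "q \<in> {1..k}" "i' \<in> {1..m}" "q' \<in> {1..k}"
      and eq: "\<bar>tile_row k d q + c i\<bar> = \<bar>tile_row k d q' + c i'\<bar>"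
    \<comment> \<open>Negating a sum reflects its row index and replaces \<open>c i'\<close> by
      \<open>- c i'\<close>, again in \<open>D\<close>. If two sums were opposite, uniqueness in the
      tiling would give \<open>c i = - c i'\<close>, against positivity.\<close>
    have "tile_row k d (k + 1 - q') = - tile_row k d q'" 
      using i(4) by (intro tile_row_reflect) simp
    then have "tile_row k d q + c i = tile_row k d q' + c i' \<or>
        tile_row k d q + c i = tile_row k d (k + 1 - q') + (- c i')"
      using eq by (simp only: abs_eq_iff minus_add_distrib)
    then consider "tile_row k d q + c i = tile_row k d q' + c i'"
      | "tile_row k d q + c i = tile_row k d (k + 1 - q') + (- c i')"
      by blast
    then show "i = i' \<and> q = q'"
    proof cases
      case 1
      then have "q = q'" "c i = c i'" using uniq[OF i(2,4) _ _ 1] i cP by (auto simp: P_def)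
      then show ?thesis using c i by (auto simp: bij_betw_def dest: inj_onD)
    next
      case 2
      have "k + 1 - q' \<in> {1..k}" using i(4) by auto
      then have "c i = - c i'"
        using uniq[OF i(2) _ _ _ 2] i cP neg by (auto simp: P_def)
      then show ?thesis using cP[OF i(1)] cP[OF i(3)] by (simp add: P_def)
    qed
  qed (use cP in \<open>auto simp: P_def\<close>)
qed

section \<open>Recovering the parameters and counting the labelings\<close>

lemma sum_tile_row:
  assumes "\<beta> permutes {1..k}"
  shows "(\<Sum>j\<in>{1..k}. tile_row k d (\<beta> j)) = 0"
proof -
  have "(\<Sum>j\<in>{1..k}. tile_row k d (\<beta> j)) = (\<Sum>j\<in>{1..k}. tile_row k d j)"
    using sum.permute[OF assms, of "tile_row k d"] by (simp add: comp_def)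
  also have "\<dots> = int d * (2 * (\<Sum>j\<in>{1..k}. int j) - int k * (int k + 1))"
    by (simp add: tile_row_def sum_distrib_left[symmetric] sum_subtractf right_diff_distrib[symmetric]
        del: right_diff_distrib)
      (simp add: algebra_simps)
  also have "2 * (\<Sum>j\<in>{1..k}. int j) = int k * (int k + 1)"
    by (induction k) (auto simp: algebra_simps)
  finally show ?thesis by simp
qed

lemma tile_row_le: "q \<in> {1..k} \<Longrightarrow> tile_row k d q \<le> tile_row k d k"
  by (auto simp: tile_row_def intro!: mult_left_mono)

text \<open>The largest value in the row is \<open>d * (k - 1)\<close>, and \<open>k - 1\<close> is
  positive. Applied in both directions this shows that the set of values determines
  \<open>d\<close>.\<close>

lemma tile_row_perm_scale:
  assumes "\<beta> permutes {1..k}" "\<beta>' permutes {1..k}" "k \<ge> 2"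
    and eq: "\<And>j. j \<in> {1..k} \<Longrightarrow> tile_row k d (\<beta> j) = tile_row k d' (\<beta>' j)"
  shows "d \<le> d'"
proof -
  obtain j where j: "j \<in> {1..k}" "\<beta> j = k"
    using permutes_image[OF assms(1)] assms(3)
    by (metis atLeastAtMost_iff imageE order_refl Suc_1 Suc_leD One_nat_def)
  have "tile_row k d k \<le> tile_row k d' k"
    using eq[OF j(1)] j permutes_in_image[OF assms(2), of j] tile_row_le by fastforce
  then show ?thesis using assms(3) by (simp add: tile_row_def)
qed

lemma card_kb_labelings_ge:
  assumes "m \<ge> 3" "odd m" "n \<ge> 6" "even n"
  shows "4 * fact (n div 2) * fact m * 2 ^ m \<le> card (kb_labelings m n)"
proof -
  define k where "k = n div 2"
  have k: "n = 2 * k" "k \<ge> 3" using assms by (auto simp: k_def)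
  \<comment> \<open>Four divisors of \<open>2 * m\<close>, distinct because \<open>m\<close> is at
    least \<open>3\<close>.\<close>
  define S where "S = {1, 2, m, 2 * m}"
  have "\<forall>d\<in>S. \<exists>c. (\<forall>i\<in>{1..m}. 0 < c i) \<and>
      (\<forall>i\<in>{1..m}. \<forall>q\<in>{1..k}.
        odd (tile_row k d q + c i) \<and> \<bar>tile_row k d q + c i\<bar> < int (2 * m * k)) \<and>
      (\<forall>i\<in>{1..m}. \<forall>q\<in>{1..k}. \<forall>i'\<in>{1..m}. \<forall>q'\<in>{1..k}.
        \<bar>tile_row k d q + c i\<bar> = \<bar>tile_row k d q' + c i'\<bar> \<longrightarrow> i = i' \<and> q = q')"
    (is "\<forall>d\<in>S. \<exists>c. ?P d c")
  proof
    fix d assume "d \<in> S"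
    then have "d dvd 2 * m" by (auto simp: S_def)
    then obtain e where "d * e = 2 * m" by (metis dvdE)
    then obtain c where "\<And>i. i \<in> {1..m} \<Longrightarrow> 0 < c i"
      and "\<And>i q. i \<in> {1..m} \<Longrightarrow> q \<in> {1..k} \<Longrightarrow>
        odd (tile_row k d q + c i) \<and> \<bar>tile_row k d q + c i\<bar> < int (2 * m * k)"
      and "\<And>i q i' q'. \<lbrakk>i \<in> {1..m}; q \<in> {1..k}; i' \<in> {1..m}; q' \<in> {1..k};
        \<bar>tile_row k d q + c i\<bar> = \<bar>tile_row k d q' + c i'\<bar>\<rbrakk> \<Longrightarrow> i = i' \<and> q = q'"
      using positive_tile_col[of d e m k] k assms(1) by (metis One_nat_def Suc_leD numeral_3_eq_3)
    then show "\<exists>c. ?P d c" by (intro exI[of _ c]) blast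
  qed
  then have "\<exists>c. \<forall>d\<in>S. ?P d (c d)" by (rule bchoice)
  then obtain c :: "nat \<Rightarrow> nat \<Rightarrow> int" where
      c_pos: "\<And>d i. d \<in> S \<Longrightarrow> i \<in> {1..m} \<Longrightarrow> 0 < c d i"
    and c_sum: "\<And>d i q. d \<in> S \<Longrightarrow> i \<in> {1..m} \<Longrightarrow> q \<in> {1..k} \<Longrightarrow>
        odd (tile_row k d q + c d i) \<and> \<bar>tile_row k d q + c d i\<bar> < int (2 * m * k)"
    and c_uniq: "\<And>d i q i' q'. \<lbrakk>d \<in> S; i \<in> {1..m}; q \<in> {1..k}; i' \<in> {1..m}; q' \<in> {1..k};
        \<bar>tile_row k d q + c d i\<bar> = \<bar>tile_row k d q' + c d i'\<bar>\<rbrakk> \<Longrightarrow> i = i' \<and> q = q'"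
    by blast
  define B where "B d \<beta> = (\<lambda>j. tile_row k d (\<beta> j))" for d and \<beta> :: "nat \<Rightarrow> nat"
  \<comment> \<open>\<open>\<sigma>\<close> is the set of rows whose translation gets a negative
    sign.\<close>
  define C where "C d \<gamma> \<sigma> = (\<lambda>i. if i \<in> \<sigma> then - c d (\<gamma> i) else c d (\<gamma> i))"
    for d and \<gamma> :: "nat \<Rightarrow> nat" and \<sigma> :: "nat set"
  have sums: "kb_signed_sums m n (B d \<beta>) (C d \<gamma> \<sigma>)"
    if d: "d \<in> S" and \<beta>: "\<beta> permutes {1..k}" and \<gamma>: "\<gamma> permutes {1..m}" for d \<beta> \<gamma> \<sigma>
  proof -
    \<comment> \<open>In a row with flipped sign, \<open>B + C\<close> is the negative of a sum with
      positive translation, in which the progression entry is reflected; \<open>\<rho>\<close> is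
      the index of that entry.\<close>
    define \<rho> where "\<rho> i j = (if i \<in> \<sigma> then k + 1 - \<beta> j else \<beta> j)" for i j
    have \<beta>r: "\<beta> j \<in> {1..k}" if "j \<in> {1..k}" for j using permutes_in_image[OF \<beta>] that by simp
    have \<gamma>r: "\<gamma> i \<in> {1..m}" if "i \<in> {1..m}" for i using permutes_in_image[OF \<gamma>] that by simp
    have \<rho>: "\<rho> i j \<in> {1..k}" if "j \<in> {1..k}" for i j using \<beta>r[OF that] by (auto simp: \<rho>_def)
    have BC: "B d \<beta> j + C d \<gamma> \<sigma> i =
        (if i \<in> \<sigma> then -1 else 1) * (tile_row k d (\<rho> i j) + c d (\<gamma> i))" if "j \<in> {1..k}" for i j
      using \<beta>r[OF that] tile_row_reflect[of "\<beta> j" k d] by (simp add: B_def C_def \<rho>_def)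
    have mn: "m * n = 2 * m * k" using k(1) by simp
    have BC_abs: "\<bar>B d \<beta> j + C d \<gamma> \<sigma> i\<bar> = \<bar>tile_row k d (\<rho> i j) + c d (\<gamma> i)\<bar>"
      and BC_odd: "odd (B d \<beta> j + C d \<gamma> \<sigma> i) = odd (tile_row k d (\<rho> i j) + c d (\<gamma> i))"
      if "j \<in> {1..k}" for i j
      unfolding BC[OF that] by (simp_all only: abs_mult even_mult_iff split: if_split) simp_all
    show ?thesis
    proof
      fix i j assume ij: "i \<in> {1..m}" "j \<in> {1..n div 2}"
      then have j: "j \<in> {1..k}" by (simp add: k_def)
      show "odd (B d \<beta> j + C d \<gamma> \<sigma> i)" "\<bar>B d \<beta> j + C d \<gamma> \<sigma> i\<bar> < int (m * n)"
        using c_sum[OF d \<gamma>r[OF ij(1)] \<rho>[OF j, of i]] unfolding BC_abs[OF j] BC_odd[OF j] mn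
        by blast+
    next
      fix i j i' j'
      assume ij: "i \<in> {1..m}" "j \<in> {1..n div 2}" "i' \<in> {1..m}" "j' \<in> {1..n div 2}"
        and eq: "\<bar>B d \<beta> j + C d \<gamma> \<sigma> i\<bar> = \<bar>B d \<beta> j' + C d \<gamma> \<sigma> i'\<bar>"
      have j: "j \<in> {1..k}" "j' \<in> {1..k}" using ij by (simp_all add: k_def)
      have "\<bar>tile_row k d (\<rho> i j) + c d (\<gamma> i)\<bar> = \<bar>tile_row k d (\<rho> i' j') + c d (\<gamma> i')\<bar>"
        using eq unfolding BC_abs[OF j(1)] BC_abs[OF j(2)] .
      then have *: "\<gamma> i = \<gamma> i'" "\<rho> i j = \<rho> i' j'"
        using c_uniq[OF d \<gamma>r[OF ij(1)] \<rho>[OF j(1)] \<gamma>r[OF ij(3)] \<rho>[OF j(2)]] by auto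
      then have i: "i = i'" using permutes_inj[OF \<gamma>] by (auto dest: injD)
      then have "\<beta> j = \<beta> j'" using *(2) \<beta>r[OF j(1)] \<beta>r[OF j(2)] by (auto simp: \<rho>_def split: if_splits)
      then show "i = i' \<and> j = j'" using i permutes_inj[OF \<beta>] by (auto dest: injD)
    qed (use assms in auto)
  qed
  define Q where "Q = S \<times> {\<beta>. \<beta> permutes {1..k}} \<times> {\<gamma>. \<gamma> permutes {1..m}} \<times> Pow {1..m}"
  define \<Phi> where "\<Phi> = (\<lambda>(d, \<beta>, \<gamma>, \<sigma>). kb_checker m n (B d \<beta>) (C d \<gamma> \<sigma>))"
  have "inj_on \<Phi> Q"
  proof (rule inj_onI)
    fix x y assume xy: "x \<in> Q" "y \<in> Q" "\<Phi> x = \<Phi> y"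
    obtain d \<beta> \<gamma> \<sigma> d' \<beta>' \<gamma>' \<sigma>'
      where x: "x = (d, \<beta>, \<gamma>, \<sigma>)" and y: "y = (d', \<beta>', \<gamma>', \<sigma>')"
      by (metis prod_cases4)
    from xy have d: "d \<in> S" "d' \<in> S" and \<beta>: "\<beta> permutes {1..k}" "\<beta>' permutes {1..k}"
      and \<gamma>: "\<gamma> permutes {1..m}" "\<gamma>' permutes {1..m}" and \<sigma>: "\<sigma> \<subseteq> {1..m}" "\<sigma>' \<subseteq> {1..m}"
      by (auto simp: Q_def x y)
    have BC: "B d \<beta> j + C d \<gamma> \<sigma> i = B d' \<beta>' j + C d' \<gamma>' \<sigma>' i"
      if "i \<in> {1..m}" "j \<in> {1..k}" for i j
    proof -
      \<comment> \<open>The first \<open>k\<close> columns are their own folds, and both labels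
        carry the same sign, so equal labels give equal sums.\<close>
      have "j \<in> {1..n}" "kb_fold n j = j" using that k by (auto simp: kb_fold_def)
      then show ?thesis
        using kb_signed_sums.two_checker[OF sums[OF d(1) \<beta>(1) \<gamma>(1)] that(1), of j \<sigma>]
          kb_signed_sums.two_checker[OF sums[OF d(2) \<beta>(2) \<gamma>(2)] that(1), of j \<sigma>'] xy(3)
        by (simp add: \<Phi>_def x y)
    qed
    \<comment> \<open>The sums fix \<open>B\<close> and \<open>C\<close> only up to a constant moved
      between them. Each \<open>B\<close> adds up to \<open>0\<close> over a row, so summing over
      \<open>j\<close> isolates \<open>k\<close> times \<open>C\<close>.\<close>
    have Ceq: "C d \<gamma> \<sigma> i = C d' \<gamma>' \<sigma>' i" if "i \<in> {1..m}" for i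
    proof -
      have "(\<Sum>j\<in>{1..k}. B d \<beta> j + C d \<gamma> \<sigma> i) = (\<Sum>j\<in>{1..k}. B d' \<beta>' j + C d' \<gamma>' \<sigma>' i)"
        using BC[OF that] by (intro sum.cong) auto
      then show ?thesis
        using sum_tile_row[OF \<beta>(1), of d] sum_tile_row[OF \<beta>(2), of d'] k(2)
        by (simp add: B_def sum.distrib)
    qed
    have Beq: "tile_row k d (\<beta> j) = tile_row k d' (\<beta>' j)" if "j \<in> {1..k}" for j
      using BC[of 1 j] Ceq[of 1] that assms(1) by (simp add: B_def)
    have dd: "d = d'"
      using tile_row_perm_scale[OF \<beta>, of d d'] tile_row_perm_scale[OF \<beta>(2,1), of d' d] Beq k(2)
      by (intro antisym) auto
    have "d > 0" using d(1) assms(1) by (auto simp: S_def)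
    then have "\<beta> j = \<beta>' j" if "j \<in> {1..k}" for j
      using Beq[OF that] by (simp add: dd tile_row_def)
    then have \<beta>\<beta>: "\<beta> = \<beta>'"
      using permutes_not_in[OF \<beta>(1)] permutes_not_in[OF \<beta>(2)] by (metis ext)
    have \<gamma>\<sigma>: "(i \<in> \<sigma>) = (i \<in> \<sigma>') \<and> \<gamma> i = \<gamma>' i" if i: "i \<in> {1..m}" for i
    proof -
      have g: "\<gamma> i \<in> {1..m}" "\<gamma>' i \<in> {1..m}"
        using permutes_in_image[OF \<gamma>(1)] permutes_in_image[OF \<gamma>(2)] i by auto
      \<comment> \<open>Since \<open>c\<close> is positive, the sign of \<open>C\<close> yields
        \<open>\<sigma>\<close> and its absolute value yields \<open>c d (\<gamma> i)\<close>;
        \<open>c_uniq\<close> with equal row indices then gives injectivity of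
        \<open>c d\<close>.\<close>
      have "(i \<in> \<sigma>) = (i \<in> \<sigma>') \<and> c d (\<gamma> i) = c d (\<gamma>' i)"
        using Ceq[OF i] c_pos[OF d(1) g(1)] c_pos[OF d(1) g(2)]
        by (auto simp: C_def dd split: if_splits)
      then show ?thesis using c_uniq[OF d(1) g(1) _ g(2), of 1 1] k(2) by auto
    qed
    then have "\<gamma> = \<gamma>'"
      using permutes_not_in[OF \<gamma>(1)] permutes_not_in[OF \<gamma>(2)] by (metis ext)
    moreover have "\<sigma> = \<sigma>'" using \<gamma>\<sigma> \<sigma> by blast
    ultimately show "x = y" using dd \<beta>\<beta> x y by simp
  qed
  moreover have "\<Phi> ` Q \<subseteq> kb_labelings m n"
    using kb_signed_sums.checker_labeling[OF sums] by (auto simp: \<Phi>_def Q_def)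
  ultimately have "card Q \<le> card (kb_labelings m n)"
    using finite_kb_labelings by (rule card_inj_on_le)
  moreover have "card S = 4" using assms(1) by (simp add: S_def)
  then have "card Q = 4 * (fact k * (fact m * 2 ^ m))"
    by (simp add: Q_def card_cartesian_product card_permutations card_Pow)
  ultimately show ?thesis by (simp add: k_def mult.assoc)
qed

theorem theorem7p5:
  fixes m n :: nat
  assumes "m \<ge> 3" and "odd m" and "n \<ge> 6" and "even n"
  shows "(n mod 4 = 2 \<longrightarrow> kb_num_nonequiv m n \<ge> (6 * 2 ^ m) * fact (m - 1)) \<and>
         (n mod 4 = 0 \<longrightarrow> kb_num_nonequiv m n \<ge> (5 * 2 ^ m) * fact (m - 1))"
proof -
  \<comment> \<open>The factor \<open>6\<close> is \<open>3!\<close>, a lower bound for the number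
    of orders of the progression.\<close>
  have "fact 3 \<le> (fact (n div 2) :: nat)" using assms by (intro fact_mono) auto
  then have "6 \<le> (fact (n div 2) :: nat)" by (simp add: fact_numeral)
  then have "4 * 6 * fact m * 2 ^ m \<le> 4 * fact (n div 2) * fact m * (2 ^ m :: nat)"
    by (intro mult_le_mono) auto
  also have "\<dots> \<le> card (kb_labelings m n)" by (rule card_kb_labelings_ge[OF assms])
  also have "\<dots> \<le> kb_num_nonequiv m n * (4 * m)"
    using assms by (intro card_kb_labelings_le) auto
  \<comment> \<open>Writing \<open>m!\<close> as \<open>m * (m - 1)!\<close>, the four choices of
    \<open>d\<close> and the factor \<open>m\<close> cancel the class bound
    \<open>4 * m\<close>.\<close>
  finally have "(6 * 2 ^ m * fact (m - 1)) * (4 * m) \<le> kb_num_nonequiv m n * (4 * m)"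
    using assms(1) fact_reduce[of m, where 'a = nat] by (simp add: algebra_simps)
  then have "6 * 2 ^ m * fact (m - 1) \<le> kb_num_nonequiv m n" using assms(1) by (subst (asm) mult_le_cancel2) simp
  moreover have "5 * 2 ^ m * fact (m - 1) \<le> 6 * 2 ^ m * (fact (m - 1) :: nat)"
    by (intro mult_le_mono) auto
  ultimately show ?thesis by linarith
qed

end
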